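(* For all $a,b>0$ with $a\ne b$, $$G<X<\frac{A+G}{2}<P<\frac{2A+G}{3}$$ and $$A<B<\frac{Q+A}{2}<T<\frac{2Q+A}{3}.$$
   Context: For $a,b>0$ with $a\neq b$: $Q=\sqrt{\frac{a^2+b^2}{2}}$, $A=\frac{a+b}{2}$, $G=\sqrt{ab}$, $P=\frac{a-b}{2\arcsin\frac{a-b}{a+b}}$ (first Seiffert mean), $T=\frac{a-b}{2\arctan\frac{a-b}{a+b}}$ (second Seiffert mean), $X=A e^{G/P-1}$, and $B=Q e^{A/T-1}$. *)

theory Defs
  imports Complex_Main
begin

definition quadratic_mean :: "real \<Rightarrow> real \<Rightarrow> real" where
  "quadratic_mean a b = sqrt ((a\<^sup>2 + b\<^sup>2) / 2)"

definition arithmetic_mean :: "real \<Rightarrow> real \<Rightarrow> real" where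
  "arithmetic_mean a b = (a + b) / 2"

definition geometric_mean :: "real \<Rightarrow> real \<Rightarrow> real" where
  "geometric_mean a b = sqrt (a * b)"

(* The means below are intended for a, b > 0 with a \<noteq> b only. At a = b the formulas for the
   Seiffert means are 0/0, which is 0 in HOL, not the continuous extension a. *)

definition seiffert_mean1 :: "real \<Rightarrow> real \<Rightarrow> real" where
  "seiffert_mean1 a b = (a - b) / (2 * arcsin ((a - b) / (a + b)))"

definition seiffert_mean2 :: "real \<Rightarrow> real \<Rightarrow> real" where
  "seiffert_mean2 a b = (a - b) / (2 * arctan ((a - b) / (a + b)))"

definition X_mean :: "real \<Rightarrow> real \<Rightarrow> real" where
  "X_mean a b = arithmetic_mean a b * exp (geometric_mean a b / seiffert_mean1 a b - 1)"

definition B_mean :: "real \<Rightarrow> real \<Rightarrow> real" where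
  "B_mean a b = quadratic_mean a b * exp (arithmetic_mean a b / seiffert_mean2 a b - 1)"

end

theory Submission
  imports Defs
begin

text \<open>
  Put \<open>z = (a - b) / (a + b)\<close> for \<open>a > b\<close>. With \<open>z = sin t\<close> one has \<open>G = A cos t\<close> and
  \<open>P = A sin t / t\<close>; with \<open>z = tan s\<close> one has \<open>A = Q cos s\<close> and \<open>T = Q sin s / s\<close>. So both
  chains are the same chain for \<open>M\<close>, \<open>N = M cos t\<close>, \<open>S = M sin t / t\<close> with
  \<open>0 < t < \<pi> / 2\<close>. There \<open>(1 + cos t) / 2 < sin t / t\<close> is \<open>u cos u < sin u\<close> at \<open>u = t / 2\<close>, and
  the exponential \<open>exp y\<close> with \<open>y = t cot t - 1\<close> satisfies
  \<open>cos t < 1 + y \<le> exp y \<le> 1 / (1 - y) < (1 + cos t) / 2\<close>, where the last step is again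
  \<open>(1 + cos t) / 2 < sin t / t\<close>. So is the positivity of the derivative of
  \<open>t (2 + cos t) - 3 sin t\<close>, which gives the upper bound on \<open>sin t / t\<close>.
\<close>

text \<open>The difference of the two sides vanishes at 0 and has derivative
  \<open>y * sin y\<close>, positive up to \<open>pi\<close>.\<close>

lemma mult_cos_less_sin:
  fixes x :: real
  assumes "0 < x" "x \<le> pi"
  shows "x * cos x < sin x"
proof -
  let ?f = "\<lambda>x::real. sin x - x * cos x"
  have "?f 0 < ?f x"
  proof (rule DERIV_pos_imp_increasing_open[OF assms(1)])
    fix y :: real assume y: "0 < y" "y < x"
    have "(?f has_real_derivative y * sin y) (at y)"
      by (auto intro!: derivative_eq_intros)
    moreover have "y * sin y > 0"
      using y assms by (intro mult_pos_pos sin_gt_zero) auto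
    ultimately show "\<exists>d. (?f has_real_derivative d) (at y) \<and> d > 0" by blast
  qed (auto intro!: continuous_intros)
  then show ?thesis by simp
qed

lemma half_one_plus_cos_less_sinc:
  fixes t :: real
  assumes "0 < t" "t < pi"
  shows "(1 + cos t) / 2 < sin t / t"
proof -
  define u where "u = t / 2"
  have t: "t = 2 * u" and u: "0 < u" "u < pi / 2" using assms by (auto simp: u_def)
  \<comment> \<open>\<open>t < pi\<close> is what keeps \<open>cos u\<close> positive, so that
    \<open>u * cos u < sin u\<close> may be multiplied by it.\<close>
  have c: "cos u > 0" using u by (intro cos_gt_zero) auto
  have "cos u * (u * cos u) < cos u * sin u"
    using mult_cos_less_sin[of u] u c by simp
  moreover have "(1 + cos t) / 2 = cos u * cos u"
    unfolding t cos_double_cos by (simp add: power2_eq_square)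
  moreover have "sin t / t = cos u * sin u / u"
    unfolding t sin_double by simp
  ultimately show ?thesis
    using u by (simp only: pos_less_divide_eq) (simp add: ac_simps)
qed

lemma sinc_less_two_plus_cos_third:
  fixes t :: real
  assumes "0 < t" "t < pi"
  shows "sin t / t < (2 + cos t) / 3"
proof -
  let ?f = "\<lambda>x::real. x * (2 + cos x) - 3 * sin x"
  have "?f 0 < ?f t"
  proof (rule DERIV_pos_imp_increasing_open[OF assms(1)])
    fix y :: real assume y: "0 < y" "y < t"
    have y': "y < pi" using y assms by simp
    have "(?f has_real_derivative 2 - 2 * cos y - y * sin y) (at y)"
      by (auto intro!: derivative_eq_intros simp: algebra_simps)
    moreover have "2 - 2 * cos y - y * sin y > 0"
    proof -
      have s: "sin y > 0" using y y' by (intro sin_gt_zero) auto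
      have "cos y < cos 0" using y y' by (intro cos_monotone_0_pi) auto
      moreover have "-1 < cos y" using y y' cos_monotone_0_pi[of y pi] by simp
      ultimately have c: "1 + cos y > 0" "cos y < 1" by auto
      \<comment> \<open>Multiplying the half-angle bound by \<open>sin y\<close> and factoring
        \<open>sin y * sin y\<close> makes \<open>1 + cos y\<close> a common factor, to be
        cancelled.\<close>
      have sq: "sin y * sin y = (1 - cos y) * (1 + cos y)"
        using sin_cos_squared_add[of y] by (simp add: algebra_simps power2_eq_square)
      have "y * (1 + cos y) < 2 * sin y"
        using half_one_plus_cos_less_sinc[OF y(1) y'] y by (simp add: field_simps)
      then have "sin y * (y * (1 + cos y)) < sin y * (2 * sin y)" using s by simp
      also have "\<dots> = 2 * (sin y * sin y)" by simp
      finally have "(y * sin y) * (1 + cos y) < (2 * (1 - cos y)) * (1 + cos y)"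
        unfolding sq by (simp only: ac_simps)
      then show ?thesis using c by (simp add: mult_less_cancel_right_pos)
    qed
    ultimately show "\<exists>d. (?f has_real_derivative d) (at y) \<and> d > 0" by blast
  qed (auto intro!: continuous_intros)
  then show ?thesis using assms by (simp add: field_simps)
qed

lemma cos_less_exp_cot:
  fixes t :: real
  assumes "0 < t" "t < pi / 2"
  shows "cos t < exp (t * cos t / sin t - 1)"
proof -
  have s: "sin t > 0" using assms by (intro sin_gt_zero) auto
  have c: "cos t > 0" using assms by (intro cos_gt_zero) auto
  \<comment> \<open>The bound serves here only to give \<open>sin t < t\<close>.\<close>
  have "sin t / t < (2 + cos t) / 3" using assms by (intro sinc_less_two_plus_cos_third) auto
  also have "\<dots> \<le> 1" by simp
  finally have "cos t * sin t < cos t * t" using assms c by simp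
  then have "cos t < 1 + (t * cos t / sin t - 1)" using s by (simp add: field_simps)
  also have "\<dots> \<le> exp (t * cos t / sin t - 1)" by (rule exp_ge_add_one_self)
  finally show ?thesis .
qed

text \<open>Passing to reciprocals lets the tangent-line bound for \<open>exp\<close>, taken at
  \<open>- y\<close>, bound \<open>exp y\<close> from above.\<close>

lemma exp_cot_less_half_one_plus_cos:
  fixes t :: real
  assumes "0 < t" "t < pi / 2"
  shows "exp (t * cos t / sin t - 1) < (1 + cos t) / 2"
proof -
  define y where "y = t * cos t / sin t - 1"
  have s: "sin t > 0" using assms by (intro sin_gt_zero) auto
  have c: "cos t > 0" using assms by (intro cos_gt_zero) auto
  have "t * (1 + cos t) < 2 * sin t"
    using half_one_plus_cos_less_sinc[of t] assms by (simp add: field_simps)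
  then have "cos t * (t * (1 + cos t)) < cos t * (2 * sin t)" using c by simp
  \<comment> \<open>Division by \<open>sin t * (1 + cos t)\<close> gives
    \<open>1 + y < 2 * cos t / (1 + cos t)\<close>, whose right side equals
    \<open>2 - 2 / (1 + cos t)\<close>.\<close>
  then have "2 / (1 + cos t) < 1 - y"
    using s c by (simp add: y_def field_simps)
  also have "\<dots> \<le> exp (- y)" using exp_ge_add_one_self[of "- y"] by simp
  finally have "2 / (1 + cos t) < inverse (exp y)" by (simp add: exp_minus)
  then show ?thesis using c by (simp add: y_def[symmetric] field_simps)
qed

text \<open>Since \<open>N / S = t * cos t / sin t\<close>, this is \<open>M\<close> times the four
  trigonometric bounds. It is applied to \<open>(M, N, S)\<close> = (A, G, P) and (Q, A, T).\<close>

lemma mean_chain: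
  fixes M N S t :: real
  assumes "0 < M" "0 < t" "t < pi / 2"
    and N: "N = M * cos t" and S: "S = M * sin t / t"
  shows "N < M * exp (N / S - 1) \<and> M * exp (N / S - 1) < (M + N) / 2 \<and>
         (M + N) / 2 < S \<and> S < (2 * M + N) / 3"
proof -
  have eqs: "t * cos t / sin t = N / S" "M * cos t = N"
    "M * ((1 + cos t) / 2) = (M + N) / 2" "M * (sin t / t) = S"
    "M * ((2 + cos t) / 3) = (2 * M + N) / 3"
    using assms by (simp_all add: algebra_simps add_divide_distrib)
  have "t < pi" using assms by simp
  then show ?thesis
    using assms(1-3)
      cos_less_exp_cot[of t, THEN mult_strict_left_mono, of M]
      exp_cot_less_half_one_plus_cos[of t, THEN mult_strict_left_mono, of M]
      half_one_plus_cos_less_sinc[of t, THEN mult_strict_left_mono, of M]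
      sinc_less_two_plus_cos_third[of t, THEN mult_strict_left_mono, of M]
    by (simp only: eqs)
qed

lemma means_commute:
  "quadratic_mean a b = quadratic_mean b a"
  "arithmetic_mean a b = arithmetic_mean b a"
  "geometric_mean a b = geometric_mean b a"
  by (simp_all add: quadratic_mean_def arithmetic_mean_def geometric_mean_def ac_simps)

text \<open>Numerator and \<open>arcsin\<close> both change sign; positivity of \<open>a\<close> and
  \<open>b\<close> keeps the argument in [-1, 1], where \<open>arcsin\<close> is odd.\<close>

lemma seiffert_mean1_commute:
  assumes "0 < a" "0 < b"
  shows "seiffert_mean1 a b = seiffert_mean1 b a"
proof -
  have "arcsin (- ((b - a) / (b + a))) = - arcsin ((b - a) / (b + a))"
    using assms by (intro arcsin_minus) (auto simp: field_simps)
  moreover have "(a - b) / (a + b) = - ((b - a) / (b + a))"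
    by (simp add: minus_divide_left add.commute)
  ultimately show ?thesis
    by (simp add: seiffert_mean1_def) (metis minus_diff_eq minus_divide_left)
qed

lemma seiffert_mean2_commute: "seiffert_mean2 a b = seiffert_mean2 b a"
proof -
  have "(a - b) / (a + b) = - ((b - a) / (b + a))"
    by (simp add: minus_divide_left add.commute)
  then show ?thesis
    by (simp add: seiffert_mean2_def arctan_minus) (metis minus_diff_eq minus_divide_left)
qed

lemma seiffert_mean1_chain:
  fixes a b :: real
  assumes "0 < b" "b < a"
  shows "geometric_mean a b < X_mean a b \<and>
         X_mean a b < (arithmetic_mean a b + geometric_mean a b) / 2 \<and>
         (arithmetic_mean a b + geometric_mean a b) / 2 < seiffert_mean1 a b \<and>
         seiffert_mean1 a b < (2 * arithmetic_mean a b + geometric_mean a b) / 3"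
proof -
  define z where "z = (a - b) / (a + b)"
  define t where "t = arcsin z"
  have z: "0 < z" "z < 1" using assms by (auto simp: z_def)
  have sin: "sin t = z" using z by (simp add: t_def)
  have t: "0 < t" "t < pi / 2"
    using z arcsin_less_arcsin[of 0 z] arcsin_less_arcsin[of z 1] by (auto simp: t_def)
  have zab: "(a + b) * z = a - b" using assms by (simp add: z_def)
  \<comment> \<open>The identity \<open>(a + b)^2 - (a - b)^2 = 4 * a * b\<close> identifies
    \<open>cos t\<close>, the root of \<open>1 - z^2\<close>, as G / A.\<close>
  have "(a + b)\<^sup>2 * (1 - z\<^sup>2) = (a + b)\<^sup>2 - ((a + b) * z)\<^sup>2"
    by (simp add: power_mult_distrib right_diff_distrib)
  also have "\<dots> = 4 * (a * b)" unfolding zab by (simp add: power2_eq_square algebra_simps)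
  finally have "1 - z\<^sup>2 = 4 * (a * b) / (a + b)\<^sup>2"
    using assms by (simp add: eq_divide_eq mult.commute)
  then have "cos t = 2 * sqrt (a * b) / (a + b)"
    using z assms by (simp add: t_def cos_arcsin real_sqrt_divide real_sqrt_mult)
  then have "geometric_mean a b = arithmetic_mean a b * cos t"
    using assms by (simp add: geometric_mean_def arithmetic_mean_def)
  moreover have "seiffert_mean1 a b = arithmetic_mean a b * sin t / t"
    using zab unfolding sin
    by (simp add: seiffert_mean1_def arithmetic_mean_def t_def z_def[symmetric])
  moreover have "arithmetic_mean a b > 0" using assms by (simp add: arithmetic_mean_def)
  ultimately show ?thesis
    unfolding X_mean_def using t by (intro mean_chain) auto
qed

lemma seiffert_mean2_chain:
  fixes a b :: real
  assumes "0 < b" "b < a"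
  shows "arithmetic_mean a b < B_mean a b \<and>
         B_mean a b < (quadratic_mean a b + arithmetic_mean a b) / 2 \<and>
         (quadratic_mean a b + arithmetic_mean a b) / 2 < seiffert_mean2 a b \<and>
         seiffert_mean2 a b < (2 * quadratic_mean a b + arithmetic_mean a b) / 3"
proof -
  define z where "z = (a - b) / (a + b)"
  define s where "s = arctan z"
  have z: "0 < z" using assms by (simp add: z_def)
  have s: "0 < s" "s < pi / 2" using z arctan_ubound by (auto simp: s_def)
  have Q: "quadratic_mean a b > 0"
    using assms by (simp add: quadratic_mean_def add_pos_pos)
  have zab: "(a + b) * z = a - b" using assms by (simp add: z_def)
  \<comment> \<open>Dually, \<open>(a + b)^2 + (a - b)^2 = 2 * (a^2 + b^2)\<close> identifies
    \<open>1 / cos s\<close>, the root of \<open>1 + z^2\<close>, as Q / A.\<close>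
  have "((a + b) / 2)\<^sup>2 * (1 + z\<^sup>2) = ((a + b)\<^sup>2 + ((a + b) * z)\<^sup>2) / 4"
    by (simp add: power_mult_distrib power_divide distrib_left)
  also have "\<dots> = (a\<^sup>2 + b\<^sup>2) / 2"
    unfolding zab by (simp add: power2_eq_square algebra_simps)
  finally have "(a\<^sup>2 + b\<^sup>2) / 2 = ((a + b) / 2)\<^sup>2 * (1 + z\<^sup>2)" by simp
  then have "quadratic_mean a b = arithmetic_mean a b * sqrt (1 + z\<^sup>2)"
    using assms by (simp add: quadratic_mean_def arithmetic_mean_def real_sqrt_mult)
  moreover have "sqrt (1 + z\<^sup>2) > 0" by (simp add: add_pos_nonneg)
  ultimately have A: "arithmetic_mean a b = quadratic_mean a b * cos s"
    by (simp add: s_def cos_arctan)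
  have "quadratic_mean a b * sin s = arithmetic_mean a b * z"
    by (simp add: A s_def sin_arctan cos_arctan)
  also have "\<dots> = (a - b) / 2" using zab by (simp add: arithmetic_mean_def)
  finally have "seiffert_mean2 a b = quadratic_mean a b * sin s / s"
    unfolding seiffert_mean2_def z_def[symmetric] s_def[symmetric] by (simp only: divide_divide_eq_left)
  then show ?thesis
    unfolding B_mean_def using s A Q by (intro mean_chain) auto
qed

theorem proposition1:
  fixes a b :: real
  assumes "a > 0" and "b > 0" and "a \<noteq> b"
  shows "(geometric_mean a b < X_mean a b \<and>
          X_mean a b < (arithmetic_mean a b + geometric_mean a b) / 2 \<and>
          (arithmetic_mean a b + geometric_mean a b) / 2 < seiffert_mean1 a b \<and>
          seiffert_mean1 a b < (2 * arithmetic_mean a b + geometric_mean a b) / 3) \<and>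
         (arithmetic_mean a b < B_mean a b \<and>
          B_mean a b < (quadratic_mean a b + arithmetic_mean a b) / 2 \<and>
          (quadratic_mean a b + arithmetic_mean a b) / 2 < seiffert_mean2 a b \<and>
          seiffert_mean2 a b < (2 * quadratic_mean a b + arithmetic_mean a b) / 3)"
proof (cases "b < a")
  case True
  then show ?thesis
    using assms seiffert_mean1_chain seiffert_mean2_chain by blast
next
  case False
  then have "a < b" using assms by simp
  \<comment> \<open>All the means are symmetric, so the case \<open>a < b\<close> follows from the
    chains for \<open>b\<close> and \<open>a\<close>.\<close>
  note swap = means_commute[of a b] seiffert_mean1_commute[OF assms(1,2)]
    seiffert_mean2_commute[of a b]
  have "X_mean a b = X_mean b a" "B_mean a b = B_mean b a"
    unfolding X_mean_def B_mean_def by (simp_all only: swap)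
  then show ?thesis
    using seiffert_mean1_chain[OF assms(1) \<open>a < b\<close>] seiffert_mean2_chain[OF assms(1) \<open>a < b\<close>]
    by (simp only: swap)
qed

end
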